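(* Let $(\mathcal{L},\alpha)=(A,L,[-,-],\phi,\alpha,\rho)$ be a hom-Lie-Rinehart algebra over $(A,\phi)$, with $\phi$ an algebra automorphism of $A$, let $(M,\beta)$ be a left module over $(\mathcal{L},\alpha)$, and let $(\mathcal{M},\beta)$ be the corresponding object of $hLR_A^\phi$ (with zero bracket and zero anchor). Given an $A$-split abelian extension $$(\mathcal{M},\beta)\xrightarrow{\ i\ }(\mathcal{L}',\alpha')\xrightarrow{\ \sigma\ }(\mathcal{L},\alpha)$$ of $(\mathcal{L},\alpha)$ by $(M,\beta)$, there is a one-to-one correspondence between the group of automorphisms of this extension and the cohomology space $H^1_{hLR}(L,M)$.
   Context: $R$ is a commutative ring with unity; all modules, algebras, tensor products and linear maps are over $R$ unless stated otherwise. $A$ is an associative commutative $R$-algebra. A hat denotes omission; $\wedge^n_R$ is the exterior power over $R$. A hom-Lie algebra $(\mathfrak{g},[-,-],\alpha)$ is an $R$-module with a skew-symmetric ($[x,x]=0$) $R$-bilinear bracket and a linear map $\alpha$ with $\alpha[x,y]=[\alpha(x),\alpha(y)]$ and $[\alpha(x),[y,z]]+[\alpha(y),[z,x]]+[\alpha(z),[x,y]]=0$. A representation of it on an $R$-module $V$ is a pair $(\theta,\beta)$ of linear maps $\theta:\mathfrak{g}\to\mathrm{End}_R(V)$, $\beta:V\to V$ with $\theta(\alpha(x))\circ\beta=\beta\circ\theta(x)$ and $\theta([x,y])\circ\beta=\theta(\alpha(x))\circ\theta(y)-\theta(\alpha(y))\circ\theta(x)$. $Der_\phi(A)$ is the $A$-module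 of $R$-linear maps $\delta:A\to A$ with $\delta(ab)=\phi(a)\delta(b)+\phi(b)\delta(a)$. A hom-Lie-Rinehart algebra over $(A,\phi)$ is a tuple $(A,L,[-,-],\phi,\alpha,\rho)$, written $(\mathcal{L},\alpha)$, with $L$ an $A$-module, $[-,-]:L\times L\to L$ skew-symmetric $R$-bilinear, $\alpha:L\to L$ linear with $\alpha[x,y]=[\alpha(x),\alpha(y)]$, and $\rho:L\to Der_\phi(A)$ $R$-linear (the anchor), such that for all $a\in A$, $x,y\in L$: (1) $(L,[-,-],\alpha)$ is a hom-Lie algebra; (2) $\alpha(a.x)=\phi(a).\alpha(x)$; (3) $(\rho,\phi)$ is a representation of $(L,[-,-],\alpha)$ on $A$; (4) $\rho(a.x)=\phi(a).\rho(x)$; (5) $[x,a.y]=\phi(a)[x,y]+\rho(x)(a)\alpha(y)$. The category $hLR_A^\phi$ has these as objects; a morphism $(\mathcal{L},\alpha)\to(\mathcal{L}',\alpha')$ is an $A$-linear map $f:L\to L'$ with $f[x,y]=[f(x),f(y)]'$, $f\circ\alpha=\alpha'\circ f$ and $\rho'\circ f=\rho$. A left module over $(\mathcal{L},\alpha)$ is a pair $(M,\beta)$ with $M$ an $A$-module, $\beta\in End_R(M)$, and a map $\theta:L\otimes M\to M$, $\theta(x,m)=\{x,m\}$, such that (1) $(\theta,\beta)$ is a representation of $(L,[-,-],\alpha)$ on $M$; (2) $\beta(a.m)=\phi(a).\beta(m)$; (3) $\{a.x,m\}=\phi(a)\{x,m\}$; (4) $\{x,a.m\}=\phi(a)\{x,m\}+\rho(x)(a).\beta(m)$.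 Cohomology: for $n\ge1$, $C^n(L;M)\subseteq Hom_R(\wedge^n_RL,M)$ consists of $f$ with $f(\alpha(x_1),\dots,\alpha(x_n))=\beta(f(x_1,\dots,x_n))$ and $f(x_1,\dots,a.x_i,\dots,x_n)=\phi^{n-1}(a)f(x_1,\dots,x_n)$. The coboundary $\delta:C^n(L;M)\to C^{n+1}(L;M)$ is $$\delta f(x_1,\dots,x_{n+1})=\sum_{i}(-1)^{i+1}\{\alpha^{n-1}(x_i),f(x_1,\dots,\hat{x_i},\dots,x_{n+1})\}+\sum_{i<j}(-1)^{i+j}f([x_i,x_j],\alpha(x_1),\dots,\widehat{\alpha(x_i)},\dots,\widehat{\alpha(x_j)},\dots,\alpha(x_{n+1})).$$ $H^*_{hLR}(L,M)$ is the cohomology of the complex $(\bigoplus_{n\ge1}C^n(L;M),\delta)$; since it starts in degree $1$, $H^1_{hLR}(L,M)=\ker(\delta:C^1(L;M)\to C^2(L;M))$. Extensions: an abelian extension of $(\mathcal{L},\alpha)$ by $(M,\beta)$ is a sequence $(\mathcal{M},\beta)\xrightarrow{i}(\mathcal{L}',\alpha')\xrightarrow{\sigma}(\mathcal{L},\alpha)$ with $(\mathcal{L}',\alpha')$ in $hLR_A^\phi$, $\sigma$ a surjective morphism of $hLR_A^\phi$, $i:M\to L'$ injective, $A$-linear, bracket-preserving, with $i\circ\beta=\alpha'\circ i$, $\rho'\circ i=0$ and $i(M)=\ker\sigma$, such that $[x,i(m)]'=i(\{\sigma(x),m\})$ for all $m\in M$, $x\in L'$. It is $A$-split if there is an $A$-linear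 map $\tau:L\to L'$ with $\sigma\circ\tau=Id_L$ and $\tau\circ\alpha=\alpha'\circ\tau$. An automorphism of the extension is an automorphism $F$ of $(\mathcal{L}',\alpha')$ in $hLR_A^\phi$ with $F\circ i=i$ and $\sigma\circ F=\sigma$. *)

theory Defs
  imports Complex_Main "HOL-Algebra.Group"
begin

text \<open>
  The carriers of \<open>R\<close>, \<open>A\<close>, \<open>L\<close>, \<open>M\<close>, ... are types; \<open>R\<close> is a commutative ring with unity
  (class \<^class>\<open>comm_ring_1\<close>).  The algebra \<open>A\<close> is only of class \<^class>\<open>comm_ring\<close>: a unit of \<open>A\<close>
  is not required, and neither is that a unit, if there is one, acts as the identity on
  \<open>A\<close>-modules.  Consequently every \<open>A\<close>-module carries its \<open>R\<close>-module structure as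
  separate data, and \<open>R\<close>-linearity of \<open>A\<close>-linear maps is asked for explicitly.  For unital \<open>A\<close> and
  unital \<open>A\<close>-modules this is the usual notion, with \<open>r x = (r 1) x\<close>.
\<close>

section \<open>Algebras, modules and linear maps\<close>

definition bilinear_map ::
  "('r::comm_ring_1 \<Rightarrow> 'x::ab_group_add \<Rightarrow> 'x) \<Rightarrow> ('r \<Rightarrow> 'y::ab_group_add \<Rightarrow> 'y) \<Rightarrow>
    ('r \<Rightarrow> 'z::ab_group_add \<Rightarrow> 'z) \<Rightarrow> ('x \<Rightarrow> 'y \<Rightarrow> 'z) \<Rightarrow> bool" where
  "bilinear_map s1 s2 s3 b \<longleftrightarrow>
    (\<forall>x. module_hom s2 s3 (\<lambda>y. b x y)) \<and> (\<forall>y. module_hom s1 s3 (\<lambda>x. b x y))"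

locale comm_algebra = module sA
  for sA :: "'r::comm_ring_1 \<Rightarrow> 'a::comm_ring \<Rightarrow> 'a" +
  assumes bilinear_mult: "bilinear_map sA sA sA (*)"

definition algebra_endomorphism :: "('r::comm_ring_1 \<Rightarrow> 'a::comm_ring \<Rightarrow> 'a) \<Rightarrow> ('a \<Rightarrow> 'a) \<Rightarrow> bool" where
  "algebra_endomorphism sA \<phi> \<longleftrightarrow> module_hom sA sA \<phi> \<and> (\<forall>a b. \<phi> (a * b) = \<phi> a * \<phi> b)"

definition algebra_automorphism :: "('r::comm_ring_1 \<Rightarrow> 'a::comm_ring \<Rightarrow> 'a) \<Rightarrow> ('a \<Rightarrow> 'a) \<Rightarrow> bool" where
  "algebra_automorphism sA \<phi> \<longleftrightarrow> algebra_endomorphism sA \<phi> \<and> bij \<phi>"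

text \<open>An \<open>A\<close>-module with a twisting map: \<open>rsmult\<close> and \<open>asmult\<close> are the actions of \<open>R\<close> and \<open>A\<close>,
  and \<open>twist\<close> is the endomorphism \<open>\<alpha>\<close> of \<open>L\<close>, respectively \<open>\<beta>\<close> of \<open>M\<close>.\<close>

record ('r, 'a, 'x) twisted_module =
  rsmult :: "'r \<Rightarrow> 'x \<Rightarrow> 'x"
  asmult :: "'a \<Rightarrow> 'x \<Rightarrow> 'x"
  twist :: "'x \<Rightarrow> 'x"

record ('r, 'a, 'l) hom_Lie_Rinehart_data = "('r, 'a, 'l) twisted_module" +
  bracket :: "'l \<Rightarrow> 'l \<Rightarrow> 'l"
  anchor :: "'l \<Rightarrow> 'a \<Rightarrow> 'a"

record ('r, 'a, 'l, 'm) left_module_data = "('r, 'a, 'm) twisted_module" +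
  action :: "'l \<Rightarrow> 'm \<Rightarrow> 'm"

locale algebra_module = comm_algebra sA
  for sA :: "'r::comm_ring_1 \<Rightarrow> 'a::comm_ring \<Rightarrow> 'a" +
  fixes X :: "('r, 'a, 'x::ab_group_add, 'z) twisted_module_scheme"
  assumes module_rsmult: "module (rsmult X)"
    and bilinear_asmult: "bilinear_map sA (rsmult X) (rsmult X) (asmult X)"
    and asmult_mult: "asmult X (a * b) x = asmult X a (asmult X b x)"

definition A_linear ::
  "('r::comm_ring_1, 'a::comm_ring, 'x::ab_group_add, 'z) twisted_module_scheme \<Rightarrow>
    ('r, 'a, 'y::ab_group_add, 'w) twisted_module_scheme \<Rightarrow> ('x \<Rightarrow> 'y) \<Rightarrow> bool" where
  "A_linear X Y f \<longleftrightarrow>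
    module_hom (rsmult X) (rsmult Y) f \<and> (\<forall>a x. f (asmult X a x) = asmult Y a (f x))"


section \<open>Hom-Lie algebras, hom-Lie-Rinehart algebras and their left modules\<close>

locale hom_Lie_algebra = module sL
  for sL :: "'r::comm_ring_1 \<Rightarrow> 'l::ab_group_add \<Rightarrow> 'l" +
  fixes br :: "'l \<Rightarrow> 'l \<Rightarrow> 'l" and \<alpha> :: "'l \<Rightarrow> 'l"
  assumes bilinear_br: "bilinear_map sL sL sL br"
    and br_self: "br x x = 0"
    and linear_\<alpha>: "module_hom sL sL \<alpha>"
    and \<alpha>_br: "\<alpha> (br x y) = br (\<alpha> x) (\<alpha> y)"
    and hom_Jacobi: "br (\<alpha> x) (br y z) + br (\<alpha> y) (br z x) + br (\<alpha> z) (br x y) = 0"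

locale hom_Lie_representation = hom_Lie_algebra sL br \<alpha> + V: module sV
  for sL :: "'r::comm_ring_1 \<Rightarrow> 'l::ab_group_add \<Rightarrow> 'l" and br \<alpha>
    and sV :: "'r \<Rightarrow> 'v::ab_group_add \<Rightarrow> 'v" +
  fixes \<theta> :: "'l \<Rightarrow> 'v \<Rightarrow> 'v" and \<beta> :: "'v \<Rightarrow> 'v"
  assumes bilinear_\<theta>: "bilinear_map sL sV sV \<theta>"
    and linear_\<beta>: "module_hom sV sV \<beta>"
    and \<theta>_\<alpha>: "\<theta> (\<alpha> x) \<circ> \<beta> = \<beta> \<circ> \<theta> x"
    and \<theta>_br: "\<theta> (br x y) (\<beta> v) = \<theta> (\<alpha> x) (\<theta> y v) - \<theta> (\<alpha> y) (\<theta> x v)"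

definition phi_derivations ::
  "('r::comm_ring_1 \<Rightarrow> 'a::comm_ring \<Rightarrow> 'a) \<Rightarrow> ('a \<Rightarrow> 'a) \<Rightarrow> ('a \<Rightarrow> 'a) set" where
  "phi_derivations sA \<phi> =
    {\<delta>. module_hom sA sA \<delta> \<and> (\<forall>a b. \<delta> (a * b) = \<phi> a * \<delta> b + \<phi> b * \<delta> a)}"

text \<open>The \<open>R\<close>-linearity of the anchor is part of \<open>hom_Lie_representation\<close>.\<close>

locale hom_Lie_Rinehart = algebra_module sA L
  for sA :: "'r::comm_ring_1 \<Rightarrow> 'a::comm_ring \<Rightarrow> 'a" and \<phi> :: "'a \<Rightarrow> 'a"
    and L :: "('r, 'a, 'l::ab_group_add) hom_Lie_Rinehart_data" +
  assumes endo_\<phi>: "algebra_endomorphism sA \<phi>"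
    and hom_Lie: "hom_Lie_algebra (rsmult L) (bracket L) (twist L)"
    and anchor_derivation: "anchor L x \<in> phi_derivations sA \<phi>"
    and twist_asmult: "twist L (asmult L a x) = asmult L (\<phi> a) (twist L x)"
    and anchor_representation:
      "hom_Lie_representation (rsmult L) (bracket L) (twist L) sA (anchor L) \<phi>"
    and anchor_asmult: "anchor L (asmult L a x) b = \<phi> a * anchor L x b"
    and bracket_asmult:
      "bracket L x (asmult L a y) =
        asmult L (\<phi> a) (bracket L x y) + asmult L (anchor L x a) (twist L y)"

locale hLR_left_module = hom_Lie_Rinehart sA \<phi> L + M: algebra_module sA M
  for sA :: "'r::comm_ring_1 \<Rightarrow> 'a::comm_ring \<Rightarrow> 'a" and \<phi> :: "'a \<Rightarrow> 'a"
    and L :: "('r, 'a, 'l::ab_group_add) hom_Lie_Rinehart_data"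
    and M :: "('r, 'a, 'l, 'm::ab_group_add) left_module_data" +
  assumes action_representation:
      "hom_Lie_representation (rsmult L) (bracket L) (twist L) (rsmult M) (action M) (twist M)"
    and M_twist_asmult: "twist M (asmult M a m) = asmult M (\<phi> a) (twist M m)"
    and action_asmult_left: "action M (asmult L a x) m = asmult M (\<phi> a) (action M x m)"
    and action_asmult_right:
      "action M x (asmult M a m) =
        asmult M (\<phi> a) (action M x m) + asmult M (anchor L x a) (twist M m)"


section \<open>The category of hom-Lie-Rinehart algebras\<close>

definition hLR_morphism ::
  "('r::comm_ring_1, 'a::comm_ring, 'l::ab_group_add) hom_Lie_Rinehart_data \<Rightarrow>
    ('r, 'a, 'k::ab_group_add) hom_Lie_Rinehart_data \<Rightarrow> ('l \<Rightarrow> 'k) \<Rightarrow> bool" where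
  "hLR_morphism L L' f \<longleftrightarrow>
    A_linear L L' f \<and>
    (\<forall>x y. f (bracket L x y) = bracket L' (f x) (f y)) \<and>
    f \<circ> twist L = twist L' \<circ> f \<and>
    anchor L' \<circ> f = anchor L"

definition hLR_automorphism ::
  "('r::comm_ring_1, 'a::comm_ring, 'l::ab_group_add) hom_Lie_Rinehart_data \<Rightarrow> ('l \<Rightarrow> 'l) \<Rightarrow> bool" where
  "hLR_automorphism L F \<longleftrightarrow>
    hLR_morphism L L F \<and> (\<exists>G. hLR_morphism L L G \<and> G \<circ> F = id \<and> F \<circ> G = id)"

definition trivial_hLR ::
  "('r, 'a::zero, 'l, 'm::zero) left_module_data \<Rightarrow> ('r, 'a, 'm) hom_Lie_Rinehart_data" where
  "trivial_hLR M =
    \<lparr>rsmult = rsmult M, asmult = asmult M, twist = twist M,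
     bracket = (\<lambda>_ _. 0), anchor = (\<lambda>_ _. 0)\<rparr>"

lemma (in hLR_left_module) hom_Lie_Rinehart_trivial: "hom_Lie_Rinehart sA \<phi> (trivial_hLR M)"
proof -
  interpret rep: hom_Lie_representation
    "rsmult L" "bracket L" "twist L" "rsmult M" "action M" "twist M"
    by (rule action_representation)
  interpret anc: hom_Lie_representation "rsmult L" "bracket L" "twist L" sA "anchor L" \<phi>
    by (rule anchor_representation)
  have z0: "module_hom s s (\<lambda>_. 0)" if "module s"
    for s :: "'r \<Rightarrow> 'y::ab_group_add \<Rightarrow> 'y"
    using that by (simp add: module_hom_iff module.scale_zero_right)
  have zA: "module_hom (rsmult M) sA (\<lambda>_. 0)"
    using M.module_rsmult module_axioms by (simp add: module_hom_iff)
  have add: "asmult M a 0 = 0" for a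
    using M.bilinear_asmult module_hom.axioms
    by (auto simp: bilinear_map_def module_hom_iff module.scale_zero_left
        dest: module_pair.module_hom_zero)
       (metis add_cancel_right_left)
  have phi0: "\<phi> 0 = 0"
    using anc.linear_\<beta> by (simp add: module_hom_iff) (metis add_cancel_right_left)
  have tw0: "twist M 0 = 0"
    using rep.linear_\<beta> by (simp add: module_hom_iff) (metis add_cancel_right_left)
  have as0: "asmult M 0 x = 0" for x
    using M.bilinear_asmult
    by (auto simp: bilinear_map_def module_hom_iff) (metis add_cancel_right_left)
  have lie: "hom_Lie_algebra (rsmult M) (\<lambda>_ _. 0) (twist M)"
    using M.module_rsmult rep.linear_\<beta>
    by (auto simp: hom_Lie_algebra_def hom_Lie_algebra_axioms_def bilinear_map_def z0 tw0)
  show ?thesis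
    unfolding hom_Lie_Rinehart_def hom_Lie_Rinehart_axioms_def algebra_module_def
      algebra_module_axioms_def hom_Lie_representation_def hom_Lie_representation_axioms_def
      trivial_hLR_def
    using comm_algebra_axioms M.module_rsmult M.bilinear_asmult lie endo_\<phi> M.asmult_mult
      anc.linear_\<beta> module_axioms zA z0[OF module_axioms]
    by (auto simp: phi_derivations_def bilinear_map_def M_twist_asmult add as0 phi0 fun_eq_iff)
qed


section \<open>Cohomology\<close>

text \<open>An element of \<open>Hom\<^sub>R(\<and>\<^sup>n L, M)\<close> is an alternating \<open>R\<close>-multilinear map of \<open>n\<close> arguments in \<open>L\<close>,
  here a function on lists of length \<open>n\<close>, extended by \<open>0\<close> to lists of any other length.\<close>

definition alternating_multilinear ::
  "('r::comm_ring_1 \<Rightarrow> 'l::ab_group_add \<Rightarrow> 'l) \<Rightarrow> ('r \<Rightarrow> 'm::ab_group_add \<Rightarrow> 'm) \<Rightarrow> nat \<Rightarrow>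
    ('l list \<Rightarrow> 'm) set" where
  "alternating_multilinear sL sM n = {f.
    (\<forall>xs. length xs \<noteq> n \<longrightarrow> f xs = 0) \<and>
    (\<forall>xs i. length xs = n \<and> i < n \<longrightarrow> module_hom sL sM (\<lambda>x. f (xs[i := x]))) \<and>
    (\<forall>xs i j. length xs = n \<and> i < j \<and> j < n \<and> xs ! i = xs ! j \<longrightarrow> f xs = 0)}"

text \<open>The complex starts in degree \<open>1\<close>; all notions below are meaningful for \<open>n \<ge> 1\<close> only.\<close>

definition cochains ::
  "('a::comm_ring \<Rightarrow> 'a) \<Rightarrow> ('r::comm_ring_1, 'a, 'l::ab_group_add) hom_Lie_Rinehart_data \<Rightarrow>
    ('r, 'a, 'l, 'm::ab_group_add) left_module_data \<Rightarrow> nat \<Rightarrow> ('l list \<Rightarrow> 'm) set" where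
  "cochains \<phi> L M n = {f \<in> alternating_multilinear (rsmult L) (rsmult M) n.
    (\<forall>xs. length xs = n \<longrightarrow> f (map (twist L) xs) = twist M (f xs)) \<and>
    (\<forall>xs i a. length xs = n \<and> i < n \<longrightarrow>
      f (xs[i := asmult L a (xs ! i)]) = asmult M ((\<phi> ^^ (n - 1)) a) (f xs))}"

text \<open>Positions in \<open>xs\<close> are counted from \<open>0\<close>, so the sign \<open>(-1)\<^sup>i\<^sup>+\<^sup>1\<close> of the \<open>i\<close>-th argument becomes
  \<open>(-1)\<^sup>i\<close>, and \<open>(-1)\<^sup>i\<^sup>+\<^sup>j\<close> is unchanged.  The list \<open>nths xs (- S)\<close> is \<open>xs\<close> with the positions in
  \<open>S\<close> omitted.\<close>

definition coboundary ::
  "('r::comm_ring_1, 'a, 'l::ab_group_add) hom_Lie_Rinehart_data \<Rightarrow>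
    ('r, 'a, 'l, 'm::ab_group_add) left_module_data \<Rightarrow> nat \<Rightarrow> ('l list \<Rightarrow> 'm) \<Rightarrow> 'l list \<Rightarrow> 'm" where
  "coboundary L M n f xs =
    (if length xs = n + 1 then
      (\<Sum>i<n + 1. rsmult M ((- 1) ^ i)
        (action M ((twist L ^^ (n - 1)) (xs ! i)) (f (nths xs (- {i}))))) +
      (\<Sum>j<n + 1. \<Sum>i<j. rsmult M ((- 1) ^ (i + j))
        (f (bracket L (xs ! i) (xs ! j) # map (twist L) (nths xs (- {i, j})))))
     else 0)"

definition cocycles ::
  "('a::comm_ring \<Rightarrow> 'a) \<Rightarrow> ('r::comm_ring_1, 'a, 'l::ab_group_add) hom_Lie_Rinehart_data \<Rightarrow>
    ('r, 'a, 'l, 'm::ab_group_add) left_module_data \<Rightarrow> nat \<Rightarrow> ('l list \<Rightarrow> 'm) set" where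
  "cocycles \<phi> L M n = {f \<in> cochains \<phi> L M n. coboundary L M n f = (\<lambda>_. 0)}"

definition coboundaries ::
  "('a::comm_ring \<Rightarrow> 'a) \<Rightarrow> ('r::comm_ring_1, 'a, 'l::ab_group_add) hom_Lie_Rinehart_data \<Rightarrow>
    ('r, 'a, 'l, 'm::ab_group_add) left_module_data \<Rightarrow> nat \<Rightarrow> ('l list \<Rightarrow> 'm) set" where
  "coboundaries \<phi> L M n =
    (if n \<le> 1 then {\<lambda>_. 0} else coboundary L M (n - 1) ` cochains \<phi> L M (n - 1))"

definition cohomology ::
  "('a::comm_ring \<Rightarrow> 'a) \<Rightarrow> ('r::comm_ring_1, 'a, 'l::ab_group_add) hom_Lie_Rinehart_data \<Rightarrow>
    ('r, 'a, 'l, 'm::ab_group_add) left_module_data \<Rightarrow> nat \<Rightarrow> ('l list \<Rightarrow> 'm) set set" where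
  "cohomology \<phi> L M n =
    cocycles \<phi> L M n // {(f, g). f \<in> cocycles \<phi> L M n \<and> g \<in> cocycles \<phi> L M n \<and>
      (\<lambda>xs. f xs - g xs) \<in> coboundaries \<phi> L M n}"

text \<open>Since there are no nonzero coboundaries in degree \<open>1\<close>, \<open>H\<^sup>1\<close> is the kernel of
  \<open>\<delta> : C\<^sup>1 \<rightarrow> C\<^sup>2\<close>, up to the identification of \<open>f\<close> with its class \<open>{f}\<close>.\<close>

lemma cohomology_1: "cohomology \<phi> L M 1 = (\<lambda>f. {f}) ` cocycles \<phi> L M 1"
proof -
  have "(\<lambda>xs. f xs - g xs) \<in> coboundaries \<phi> L M 1 \<longleftrightarrow> g = f" for f g
    by (auto simp: coboundaries_def fun_eq_iff)
  then show ?thesis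
    by (auto simp: cohomology_def quotient_def)
qed

lemma coboundary_1:
  "coboundary L M 1 f [x, y] =
    rsmult M 1 (action M x (f [y])) + rsmult M (- 1) (action M y (f [x])) +
    rsmult M (- 1) (f [bracket L x y])"
  by (simp add: coboundary_def nths_Cons numeral_2_eq_2 lessThan_Suc add.commute)


section \<open>Abelian extensions\<close>

text \<open>The conditions on \<open>i\<close> (\<open>A\<close>-linear, bracket-preserving, \<open>i \<circ> \<beta> = \<alpha>' \<circ> i\<close>, \<open>\<rho>' \<circ> i = 0\<close>) say that
  \<open>i\<close> is a morphism from \<open>M\<close>, with zero bracket and zero anchor, to \<open>L'\<close>.\<close>

locale abelian_extension =
  hLR_left_module sA \<phi> L M + L': hom_Lie_Rinehart sA \<phi> L'
  for sA :: "'r::comm_ring_1 \<Rightarrow> 'a::comm_ring \<Rightarrow> 'a" and \<phi> :: "'a \<Rightarrow> 'a"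
    and L :: "('r, 'a, 'l::ab_group_add) hom_Lie_Rinehart_data"
    and M :: "('r, 'a, 'l, 'm::ab_group_add) left_module_data"
    and L' :: "('r, 'a, 'k::ab_group_add) hom_Lie_Rinehart_data" +
  fixes i :: "'m \<Rightarrow> 'k" and \<sigma> :: "'k \<Rightarrow> 'l"
  assumes morphism_\<sigma>: "hLR_morphism L' L \<sigma>"
    and surj_\<sigma>: "surj \<sigma>"
    and morphism_i: "hLR_morphism (trivial_hLR M) L' i"
    and inj_i: "inj i"
    and exact: "range i = {x. \<sigma> x = 0}"
    and bracket_i: "bracket L' x (i m) = i (action M (\<sigma> x) m)"

definition A_split ::
  "('r::comm_ring_1, 'a::comm_ring, 'l::ab_group_add) hom_Lie_Rinehart_data \<Rightarrow>
    ('r, 'a, 'k::ab_group_add) hom_Lie_Rinehart_data \<Rightarrow> ('k \<Rightarrow> 'l) \<Rightarrow> bool" where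
  "A_split L L' \<sigma> \<longleftrightarrow>
    (\<exists>\<tau>. A_linear L L' \<tau> \<and> \<sigma> \<circ> \<tau> = id \<and> \<tau> \<circ> twist L = twist L' \<circ> \<tau>)"

definition extension_automorphism_group ::
  "('r::comm_ring_1, 'a::comm_ring, 'k::ab_group_add) hom_Lie_Rinehart_data \<Rightarrow>
    ('m \<Rightarrow> 'k) \<Rightarrow> ('k \<Rightarrow> 'l) \<Rightarrow> ('k \<Rightarrow> 'k) monoid" where
  "extension_automorphism_group L' i \<sigma> =
    \<lparr>carrier = {F. hLR_automorphism L' F \<and> F \<circ> i = i \<and> \<sigma> \<circ> F = \<sigma>}, mult = (\<circ>), one = id\<rparr>"

lemma (in abelian_extension) group_extension_automorphism_group:
  "group (extension_automorphism_group L' i \<sigma>)"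
proof (rule groupI)
  have comp: "hLR_morphism L' L' (F \<circ> G)" if "hLR_morphism L' L' F" "hLR_morphism L' L' G" for F G
    using that by (auto simp: hLR_morphism_def A_linear_def module_hom_iff fun_eq_iff)
  let ?A = "extension_automorphism_group L' i \<sigma>"
  show "F \<otimes>\<^bsub>?A\<^esub> G \<in> carrier ?A" if "F \<in> carrier ?A" "G \<in> carrier ?A" for F G
  proof -
    from that obtain F' G' where
      "hLR_morphism L' L' F'" "F' \<circ> F = id" "F \<circ> F' = id"
      "hLR_morphism L' L' G'" "G' \<circ> G = id" "G \<circ> G' = id"
      by (auto simp: extension_automorphism_group_def hLR_automorphism_def)
    then have "\<exists>H. hLR_morphism L' L' H \<and> H \<circ> (F \<circ> G) = id \<and> (F \<circ> G) \<circ> H = id"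
      by (intro exI[of _ "G' \<circ> F'"]) (auto simp: comp fun_eq_iff)
    with that show ?thesis
      by (auto simp: extension_automorphism_group_def hLR_automorphism_def comp)
        (auto simp: fun_eq_iff)
  qed
  have "hLR_morphism L' L' id"
    using L'.module_rsmult by (auto simp: hLR_morphism_def A_linear_def module_hom_iff)
  then show "\<one>\<^bsub>?A\<^esub> \<in> carrier ?A"
    by (auto simp: extension_automorphism_group_def hLR_automorphism_def)
  show "\<exists>G \<in> carrier ?A. G \<otimes>\<^bsub>?A\<^esub> F = \<one>\<^bsub>?A\<^esub>" if "F \<in> carrier ?A" for F
  proof -
    from that obtain G where G: "hLR_morphism L' L' G" "G \<circ> F = id" "F \<circ> G = id"
      by (auto simp: extension_automorphism_group_def hLR_automorphism_def)
    have "G \<circ> i = G \<circ> (F \<circ> i)" "\<sigma> \<circ> G = \<sigma> \<circ> F \<circ> G"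
      using that by (auto simp: extension_automorphism_group_def)
    then have "G \<circ> i = i" "\<sigma> \<circ> G = \<sigma>"
      using G by (simp_all add: comp_assoc[symmetric]) (simp add: comp_assoc)
    with G that show ?thesis
      by (auto simp: extension_automorphism_group_def hLR_automorphism_def)
  qed
qed (auto simp: extension_automorphism_group_def)

end

theory Submission
  imports Defs
begin

text \<open>
  An automorphism \<open>F\<close> of the extension differs from the identity by a map \<open>F - id\<close> that vanishes on
  \<open>i(M) = ker \<sigma>\<close> and takes values in \<open>ker \<sigma> = i(M)\<close>; so \<open>F - id = i \<circ> g \<circ> \<sigma>\<close> for a unique
  \<open>g : L \<rightarrow> M\<close>.  As \<open>[x, i(m)]' = i({\<sigma>(x), m})\<close> and \<open>i(M)\<close> has zero bracket, \<open>F\<close> preserves brackets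
  iff \<open>g([x, y]) = {x, g(y)} - {y, g(x)}\<close>, which is the cocycle condition in degree \<open>1\<close>.
  The inverse of \<open>id + i \<circ> g \<circ> \<sigma>\<close> is \<open>id - i \<circ> g \<circ> \<sigma>\<close>.
\<close>

section \<open>Cohomology in degree one\<close>

definition twisted_derivations ::
  "('r::comm_ring_1, 'a::comm_ring, 'l::ab_group_add) hom_Lie_Rinehart_data \<Rightarrow>
    ('r, 'a, 'l, 'm::ab_group_add) left_module_data \<Rightarrow> ('l \<Rightarrow> 'm) set" where
  "twisted_derivations L M = {g. A_linear L M g \<and> (\<forall>x. g (twist L x) = twist M (g x)) \<and>
    (\<forall>x y. g (bracket L x y) = action M x (g y) - action M y (g x))}"

text \<open>Cochains are functions on lists that are \<open>0\<close> on lists of the wrong length;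
  this carries a map on \<open>L\<close> over to that encoding.\<close>

definition unary :: "('l \<Rightarrow> 'm::zero) \<Rightarrow> 'l list \<Rightarrow> 'm" where
  "unary g xs = (if length xs = 1 then g (hd xs) else 0)"

lemma unary_singleton [simp]: "unary g [x] = g x"
  by (simp add: unary_def)

text \<open>With a single argument alternation is vacuous, and the exponent \<open>n - 1 = 0\<close>
  turns homogeneity twisted by a power of \<phi> into plain A-linearity.\<close>

lemma unary_in_cochains_1_iff:
  fixes L :: "('r::comm_ring_1, 'a::comm_ring, 'l::ab_group_add) hom_Lie_Rinehart_data"
  shows "unary g \<in> cochains \<phi> L M 1 \<longleftrightarrow> A_linear L M g \<and> (\<forall>x. g (twist L x) = twist M (g x))"
proof -
  have ex: "(\<forall>xs. length xs = 1 \<longrightarrow> P xs) \<longleftrightarrow> (\<forall>x. P [x])" for P :: "'l list \<Rightarrow> bool"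
    by (auto simp: length_Suc_conv)
  have "unary g \<in> alternating_multilinear (rsmult L) (rsmult M) 1 \<longleftrightarrow>
      module_hom (rsmult L) (rsmult M) g"
    using ex[of "\<lambda>xs. module_hom (rsmult L) (rsmult M) (\<lambda>x. unary g (xs[0 := x]))"]
    by (auto simp: alternating_multilinear_def unary_def)
  then show ?thesis
    using ex[of "\<lambda>xs. unary g (map (twist L) xs) = twist M (unary g xs)"]
      ex[of "\<lambda>xs. \<forall>a. unary g (xs[0 := asmult L a (xs ! 0)]) = asmult M a (unary g xs)"]
    by (auto simp: cochains_def A_linear_def)
qed

lemma cochain_1_eq_unary:
  assumes "f \<in> cochains \<phi> L M 1"
  shows "f = unary (\<lambda>x. f [x])"
  using assms
  by (auto simp: cochains_def alternating_multilinear_def unary_def fun_eq_iff length_Suc_conv)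

lemma coboundary_1_eq_0_iff:
  assumes "module (rsmult M)"
  shows "coboundary L M 1 f = (\<lambda>_. 0) \<longleftrightarrow>
    (\<forall>x y. f [bracket L x y] = action M x (f [y]) - action M y (f [x]))"
proof -
  have eq: "coboundary L M 1 f [x, y] =
      action M x (f [y]) - action M y (f [x]) - f [bracket L x y]" for x y
    unfolding coboundary_1
    by (simp add: module.scale_minus_left[OF assms] module.scale_one[OF assms])
  \<comment> \<open>Only lists of length two carry information: on all others the coboundary is
    \<open>0\<close> by definition.\<close>
  have "coboundary L M 1 f = (\<lambda>_. 0) \<longleftrightarrow> (\<forall>x y. coboundary L M 1 f [x, y] = 0)"
  proof
    assume *: "\<forall>x y. coboundary L M 1 f [x, y] = 0"
    show "coboundary L M 1 f = (\<lambda>_. 0)"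
    proof
      fix xs
      show "coboundary L M 1 f xs = 0"
      proof (cases "length xs = 2")
        case True
        then obtain x y where "xs = [x, y]"
          by (auto simp: length_Suc_conv numeral_2_eq_2)
        with * show ?thesis by simp
      qed (simp add: coboundary_def)
    qed
  qed simp
  also have "\<dots> \<longleftrightarrow> (\<forall>x y. f [bracket L x y] = action M x (f [y]) - action M y (f [x]))"
    unfolding eq by (metis eq_iff_diff_eq_0)
  finally show ?thesis .
qed

lemma cocycles_1:
  assumes "module (rsmult M)"
  shows "cocycles \<phi> L M 1 = unary ` twisted_derivations L M"
proof -
  have "unary g \<in> cocycles \<phi> L M 1 \<longleftrightarrow> g \<in> twisted_derivations L M" for g
    unfolding cocycles_def mem_Collect_eq unary_in_cochains_1_iff coboundary_1_eq_0_iff[OF assms]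
    by (simp add: twisted_derivations_def)
  moreover have "f = unary (\<lambda>x. f [x])" if "f \<in> cocycles \<phi> L M 1" for f
    using that cochain_1_eq_unary by (auto simp: cocycles_def)
  ultimately show ?thesis
    by (intro equalityI subsetI) (metis imageI, blast)
qed

text \<open>The classes in degree one are singletons, and \<open>g\<close> is recovered from
  \<open>unary g\<close> by evaluation on one-element lists.\<close>

lemma bij_betw_cohomology_1:
  assumes "module (rsmult M)"
  shows "bij_betw (\<lambda>g. {unary g}) (twisted_derivations L M) (cohomology \<phi> L M 1)"
  unfolding cohomology_1 cocycles_1[OF assms] bij_betw_def
  by (auto simp: inj_on_def image_image fun_eq_iff) (metis unary_singleton)

section \<open>Shears of an abelian extension\<close>

context abelian_extension
begin

text \<open>Here \<open>g\<close> is arbitrary, so that each property of an automorphism can be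
  translated into an equivalent condition on \<open>g\<close>.\<close>

definition shear :: "('l \<Rightarrow> 'm) \<Rightarrow> 'k \<Rightarrow> 'k" where
  "shear g x = x + i (g (\<sigma> x))"

lemma action_bilinear: "bilinear_map (rsmult L) (rsmult M) (rsmult M) (action M)"
  using action_representation
  by (simp add: hom_Lie_representation_def hom_Lie_representation_axioms_def)

lemma module_hom_i: "module_hom (rsmult M) (rsmult L') i"
  and i_asmult: "i (asmult M a m) = asmult L' a (i m)"
  and i_twist: "i (twist M m) = twist L' (i m)"
  and anchor_i: "anchor L' (i m) a = 0"
  using morphism_i
  by (auto simp: hLR_morphism_def A_linear_def trivial_hLR_def fun_eq_iff module_hom_iff)

lemma module_hom_\<sigma>: "module_hom (rsmult L') (rsmult L) \<sigma>"
  and \<sigma>_asmult: "\<sigma> (asmult L' a x) = asmult L a (\<sigma> x)"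
  and \<sigma>_twist: "\<sigma> (twist L' x) = twist L (\<sigma> x)"
  and \<sigma>_bracket: "\<sigma> (bracket L' x y) = bracket L (\<sigma> x) (\<sigma> y)"
  using morphism_\<sigma> by (auto simp: hLR_morphism_def A_linear_def fun_eq_iff)

lemmas i_add = module_hom.add[OF module_hom_i]
  and i_diff = module_hom.diff[OF module_hom_i]
  and i_neg = module_hom.neg[OF module_hom_i]
  and i_0 = module_hom.zero[OF module_hom_i]
  and i_scale = module_hom.scale[OF module_hom_i]
  and \<sigma>_add = module_hom.add[OF module_hom_\<sigma>]
  and \<sigma>_diff = module_hom.diff[OF module_hom_\<sigma>]
  and \<sigma>_scale = module_hom.scale[OF module_hom_\<sigma>]

lemma \<sigma>_i [simp]: "\<sigma> (i m) = 0"
  using exact by blast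

lemma i_eq_iff [simp]: "i m = i n \<longleftrightarrow> m = n"
  using inj_i by (simp add: inj_eq)

lemma module_hom_bracket':
  "module_hom (rsmult L') (rsmult L') (bracket L' x)"
  "module_hom (rsmult L') (rsmult L') (\<lambda>x. bracket L' x y)"
  using L'.hom_Lie
  by (auto simp: hom_Lie_algebra_def hom_Lie_algebra_axioms_def bilinear_map_def)

lemmas bracket'_add = module_hom_bracket'[THEN module_hom.add]

lemma bracket'_skew: "bracket L' y x = - bracket L' x y"
proof -
  have "bracket L' z z = 0" for z
    using L'.hom_Lie by (simp add: hom_Lie_algebra_def hom_Lie_algebra_axioms_def)
  from this[of "x + y"] this[of x] this[of y] have "bracket L' x y + bracket L' y x = 0"
    by (simp add: bracket'_add add.commute)
  then show ?thesis
    by (simp add: eq_neg_iff_add_eq_0 add.commute)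
qed

lemma i_bracket: "bracket L' (i m) x = - i (action M (\<sigma> x) m)"
  by (subst bracket'_skew) (simp add: bracket_i)

lemma bracket'_add_i:
  "bracket L' (x + i m) (y + i n) =
    bracket L' x y + i (action M (\<sigma> x) n - action M (\<sigma> y) m)"
proof -
  \<comment> \<open>The term \<open>bracket L' (i m) (i n)\<close> equals
    \<open>i (action M (\<sigma> (i m)) n)\<close>, which vanishes because
    \<open>\<sigma> (i m) = 0\<close>.\<close>
  have "action M 0 n = 0"
    using action_bilinear module_hom.zero by (force simp: bilinear_map_def)
  then show ?thesis
    by (simp add: bracket'_add bracket_i i_bracket i_diff i_0 \<sigma>_add)
qed

lemma twist'_add: "twist L' (x + y) = twist L' x + twist L' y"
  using L'.hom_Lie
  by (auto simp: hom_Lie_algebra_def hom_Lie_algebra_axioms_def dest: module_hom.add)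

lemma asmult'_add: "asmult L' a (x + y) = asmult L' a x + asmult L' a y"
  using L'.bilinear_asmult by (auto simp: bilinear_map_def dest: module_hom.add)

text \<open>The anchor is additive and kills the image of \<open>i\<close>; hence every shear is
  compatible with it.\<close>

lemma anchor'_add_i: "anchor L' (x + i m) = anchor L' x"
proof
  fix a
  have "module_hom (rsmult L') sA (\<lambda>x. anchor L' x a)"
    using L'.anchor_representation
    by (auto simp: hom_Lie_representation_def hom_Lie_representation_axioms_def bilinear_map_def)
  from module_hom.add[OF this] show "anchor L' (x + i m) a = anchor L' x a"
    by (simp add: anchor_i)
qed

lemmas rsmult'_add = module.scale_right_distrib[OF L'.module_rsmult]

text \<open>Apart from the anchor condition, which always holds, each condition on
  \<open>shear g\<close> at \<open>x\<close> becomes one on \<open>g\<close> at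
  \<open>\<sigma> x\<close>: the contributions of the identity cancel, and \<open>i\<close>, being
  injective and compatible with the operations, can be stripped off.\<close>

lemma hLR_morphism_shear_iff:
  "hLR_morphism L' L' (shear g) \<longleftrightarrow> g \<in> twisted_derivations L M"
proof -
  have add: "shear g (x + y) = shear g x + shear g y \<longleftrightarrow> g (\<sigma> x + \<sigma> y) = g (\<sigma> x) + g (\<sigma> y)"
    for x y
    by (simp add: shear_def \<sigma>_add add.assoc add.left_commute[of _ y] flip: i_add)
  have scale: "shear g (rsmult L' r x) = rsmult L' r (shear g x) \<longleftrightarrow>
      g (rsmult L r (\<sigma> x)) = rsmult M r (g (\<sigma> x))" for r x
    by (simp add: shear_def \<sigma>_scale rsmult'_add flip: i_scale)
  have asmult: "shear g (asmult L' a x) = asmult L' a (shear g x) \<longleftrightarrow>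
      g (asmult L a (\<sigma> x)) = asmult M a (g (\<sigma> x))" for a x
    by (simp add: shear_def \<sigma>_asmult asmult'_add flip: i_asmult)
  have twist: "shear g (twist L' x) = twist L' (shear g x) \<longleftrightarrow>
      g (twist L (\<sigma> x)) = twist M (g (\<sigma> x))" for x
    by (simp add: shear_def \<sigma>_twist twist'_add flip: i_twist)
  have bracket: "shear g (bracket L' x y) = bracket L' (shear g x) (shear g y) \<longleftrightarrow>
      g (bracket L (\<sigma> x) (\<sigma> y)) = action M (\<sigma> x) (g (\<sigma> y)) - action M (\<sigma> y) (g (\<sigma> x))"
    for x y
    by (simp add: shear_def \<sigma>_bracket bracket'_add_i)
  have anchor: "anchor L' \<circ> shear g = anchor L'"
    by (simp add: fun_eq_iff shear_def anchor'_add_i)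
  \<comment> \<open>As \<sigma> is onto, conditions at all points \<open>\<sigma> x\<close> are
    conditions on all of \<open>L\<close>.\<close>
  have all1: "(\<forall>x. P (\<sigma> x)) \<longleftrightarrow> (\<forall>l. P l)" for P
    using surj_\<sigma> by (metis surjD)
  have all2: "(\<forall>x y. P (\<sigma> x) (\<sigma> y)) \<longleftrightarrow> (\<forall>l l'. P l l')" for P
    using surj_\<sigma> by (metis surjD)
  have "module_hom (rsmult L') (rsmult L') (shear g) \<longleftrightarrow> module_hom (rsmult L) (rsmult M) g"
    unfolding module_hom_iff add scale
    using L'.module_rsmult module_hom_\<sigma> module_hom_i
      all2[of "\<lambda>l l'. g (l + l') = g l + g l'"] all1[of "\<lambda>l. g (rsmult L _ l) = rsmult M _ (g l)"]
    by (simp add: module_hom_iff)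
  moreover have "(\<forall>a x. shear g (asmult L' a x) = asmult L' a (shear g x)) \<longleftrightarrow>
      (\<forall>a l. g (asmult L a l) = asmult M a (g l))"
    unfolding asmult all1[of "\<lambda>l. g (asmult L _ l) = asmult M _ (g l)"] ..
  moreover have "shear g \<circ> twist L' = twist L' \<circ> shear g \<longleftrightarrow> (\<forall>l. g (twist L l) = twist M (g l))"
    unfolding fun_eq_iff comp_apply twist all1[of "\<lambda>l. g (twist L l) = twist M (g l)"] ..
  moreover have "(\<forall>x y. shear g (bracket L' x y) = bracket L' (shear g x) (shear g y)) \<longleftrightarrow>
      (\<forall>l l'. g (bracket L l l') = action M l (g l') - action M l' (g l))"
    unfolding bracket all2[of "\<lambda>l l'. g (bracket L l l') = action M l (g l') - action M l' (g l)"] ..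
  ultimately show ?thesis
    unfolding hLR_morphism_def twisted_derivations_def A_linear_def
    using anchor by blast
qed

text \<open>A displacement by an element of the image of \<open>i\<close> does not change the value
  of \<sigma>, so composing two shears adds their maps \<open>g\<close>.\<close>

lemma shear_uminus: "shear (\<lambda>l. - g l) \<circ> shear g = id" "shear g \<circ> shear (\<lambda>l. - g l) = id"
  by (simp_all add: fun_eq_iff shear_def \<sigma>_add \<sigma>_diff i_neg)

text \<open>This makes the inverse of a shear a morphism again. Negation passes through all
  operations of \<open>M\<close> in the conditions, as these are additive.\<close>

lemma uminus_in_twisted_derivations:
  assumes "g \<in> twisted_derivations L M"
  shows "(\<lambda>l. - g l) \<in> twisted_derivations L M"
proof -
  have asmult: "module_hom (rsmult M) (rsmult M) (asmult M a)" for a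
    using M.bilinear_asmult by (simp add: bilinear_map_def)
  have action: "module_hom (rsmult M) (rsmult M) (action M l)" for l
    using action_bilinear by (simp add: bilinear_map_def)
  have twist: "module_hom (rsmult M) (rsmult M) (twist M)"
    using action_representation
    by (simp add: hom_Lie_representation_def hom_Lie_representation_axioms_def)
  show ?thesis
    using assms
    by (auto simp: twisted_derivations_def A_linear_def module_hom_iff
        module.scale_minus_right module_hom.neg[OF asmult] module_hom.neg[OF action]
        module_hom.neg[OF twist])
qed

lemma shear_in_automorphisms_iff:
  "shear g \<in> carrier (extension_automorphism_group L' i \<sigma>) \<longleftrightarrow> g \<in> twisted_derivations L M"
proof
  assume g: "g \<in> twisted_derivations L M"
  \<comment> \<open>Since \<sigma> vanishes on the image of \<open>i\<close>, the displacement there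
    is \<open>i (g 0)\<close>; it has to be zero for \<open>shear g\<close> to fix that
    image.\<close>
  then have "g 0 = 0"
    by (auto simp: twisted_derivations_def A_linear_def dest: module_hom.zero)
  then have "shear g \<circ> i = i" "\<sigma> \<circ> shear g = \<sigma>"
    by (simp_all add: fun_eq_iff shear_def \<sigma>_add i_0)
  with g show "shear g \<in> carrier (extension_automorphism_group L' i \<sigma>)"
    using uminus_in_twisted_derivations[OF g] shear_uminus[of g]
    unfolding extension_automorphism_group_def hLR_automorphism_def
    by simp (metis hLR_morphism_shear_iff)
qed (simp add: extension_automorphism_group_def hLR_automorphism_def hLR_morphism_shear_iff)

text \<open>The displacement \<open>F x - x\<close> lies in the image of \<open>i\<close> and is
  constant on each fibre of \<sigma>: two points of a fibre differ by an element of that image,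
  which \<open>F\<close> fixes. So it depends on \<open>\<sigma> x\<close> only.\<close>

lemma automorphism_eq_shear:
  assumes "F \<in> carrier (extension_automorphism_group L' i \<sigma>)"
  obtains g where "F = shear g"
proof -
  have hom: "module_hom (rsmult L') (rsmult L') F" and Fi: "F (i m) = i m" and \<sigma>F: "\<sigma> (F x) = \<sigma> x"
    for m x
    using assms
    by (auto simp: extension_automorphism_group_def hLR_automorphism_def hLR_morphism_def
        A_linear_def fun_eq_iff)
  \<comment> \<open>One \<open>m\<close> serves the whole fibre over \<open>l\<close>; choosing such
    an \<open>m\<close> for every \<open>l\<close> yields \<open>g\<close>.\<close>
  have "\<exists>m. \<forall>x. \<sigma> x = l \<longrightarrow> F x = x + i m" for l
  proof -
    obtain s where s: "\<sigma> s = l"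
      using surj_\<sigma> by (metis surjD)
    have "F s - s \<in> range i"
      unfolding exact by (simp add: \<sigma>_diff \<sigma>F)
    then obtain m where m: "F s - s = i m"
      by blast
    have "F x = x + i m" if "\<sigma> x = l" for x
    proof -
      have "x - s \<in> range i"
        unfolding exact by (simp add: \<sigma>_diff that s)
      then have "F x - F s = x - s"
        using Fi by (auto simp flip: module_hom.diff[OF hom])
      with m show ?thesis
        by (simp add: algebra_simps)
    qed
    then show ?thesis by blast
  qed
  then obtain g where "F x = x + i (g (\<sigma> x))" for x
    by metis
  then have "F = shear g"
    by (simp add: fun_eq_iff shear_def)
  with that show ?thesis .
qed

lemma bij_betw_shear:
  "bij_betw shear (twisted_derivations L M) (carrier (extension_automorphism_group L' i \<sigma>))"
proof (rule bij_betw_imageI)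
  show "inj_on shear (twisted_derivations L M)"
    \<comment> \<open>The values of two maps at \<open>l\<close> are compared by evaluating their
      shears at a preimage of \<open>l\<close> and cancelling that point and
      \<open>i\<close>.\<close>
    by (rule inj_onI) (metis add_left_cancel ext i_eq_iff shear_def surjD surj_\<sigma>)
  show "shear ` twisted_derivations L M = carrier (extension_automorphism_group L' i \<sigma>)"
    using shear_in_automorphisms_iff by (blast elim: automorphism_eq_shear)
qed

end

theorem theorem5p7:
  fixes sA :: "'r::comm_ring_1 \<Rightarrow> 'a::comm_ring \<Rightarrow> 'a" and \<phi> :: "'a \<Rightarrow> 'a"
    and L :: "('r, 'a, 'l::ab_group_add) hom_Lie_Rinehart_data"
    and M :: "('r, 'a, 'l, 'm::ab_group_add) left_module_data"
    and L' :: "('r, 'a, 'k::ab_group_add) hom_Lie_Rinehart_data"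
    and i :: "'m \<Rightarrow> 'k" and \<sigma> :: "'k \<Rightarrow> 'l"
  assumes "hom_Lie_Rinehart sA \<phi> L"
    and "algebra_automorphism sA \<phi>"
    and "hLR_left_module sA \<phi> L M"
    and "abelian_extension sA \<phi> L M L' i \<sigma>"
    and "A_split L L' \<sigma>"
  shows "\<exists>h. bij_betw h (carrier (extension_automorphism_group L' i \<sigma>)) (cohomology \<phi> L M 1)"
proof -
  interpret abelian_extension sA \<phi> L M L' i \<sigma>
    by fact
  show ?thesis
    \<comment> \<open>An automorphism is sent to the \<open>g\<close> of which it is the shear, and
      this \<open>g\<close> to the class of \<open>unary g\<close>.\<close>
    using bij_betw_trans[OF bij_betw_inv_into[OF bij_betw_shear]
        bij_betw_cohomology_1[OF M.module_rsmult]]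
    by blast
qed

end
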